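(* Let ${\bf x}\sim\mathcal N(0,\sigma_{\bf x}^2)$, ${\bf v}\sim\mathcal N(0,\sigma_{\bf v}^2)$, ${\bf w}\sim\mathcal N(0,\sigma_{\bf w}^2)$ be independent with positive variances. Let the encoder use a linear strategy ${\bf m}=\gamma^e({\bf x})=A{\bf x}$ with $A\in\mathbb R$. The decoder chooses $\alpha\in[0,1]$ and a function $\gamma^d$ so as to minimize $J^d={\bf E}[({\bf x}-\hat{\bf x})^2]$, where $\hat{\bf x}=\gamma^d({\bf r})$ and ${\bf r}=\alpha({\bf m}+{\bf v})+(1-\alpha)({\bf x}+{\bf w})$. Then the optimal decoder uses a linear strategy $\hat{\bf x}=\gamma^d({\bf r})=K{\bf r}$, and an optimal pair $(\alpha^*,K^* )$ and the optimal cost $J^{d,*}$ are as follows. (1) If $A\ge 0$: $$\alpha^*=\frac{A\sigma_{\bf w}^2}{A\sigma_{\bf w}^2+\sigma_{\bf v}^2},\quad K^*=\frac{A\sigma_{\bf x}^2\sigma_{\bf w}^2+\sigma_{\bf x}^2\sigma_{\bf v}^2}{A^2\sigma_{\bf x}^2\sigma_{\bf w}^2+\sigma_{\bf x}^2\sigma_{\bf v}^2+\sigma_{\bf w}^2\sigma_{\bf v}^2},\quad J^{d,*}=\frac{\sigma_{\bf x}^2\sigma_{\bf w}^2\sigma_{\bf v}^2}{(A^2\sigma_{\bf w}^2+\sigma_{\bf v}^2)\sigma_{\bf x}^2+\sigma_{\bf w}^2\sigma_{\bf v}^2}.$$ (2) If $-\sqrt{\sigma_{\bf v}^2/\sigma_{\bf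 w}^2}\le A\le 0$: $$\alpha^*=0,\quad K^*=\frac{\sigma_{\bf x}^2}{\sigma_{\bf x}^2+\sigma_{\bf w}^2},\quad J^{d,*}=\frac{\sigma_{\bf x}^2\sigma_{\bf w}^2}{\sigma_{\bf x}^2+\sigma_{\bf w}^2}.$$ (3) If $A\le -\sqrt{\sigma_{\bf v}^2/\sigma_{\bf w}^2}$: $$\alpha^*=1,\quad K^*=\frac{A\sigma_{\bf x}^2}{A^2\sigma_{\bf x}^2+\sigma_{\bf v}^2},\quad J^{d,*}=\frac{\sigma_{\bf x}^2\sigma_{\bf v}^2}{A^2\sigma_{\bf x}^2+\sigma_{\bf v}^2}.$$
   Context: Setting: an encoder observes a scalar Gaussian source ${\bf x}$ and sends ${\bf m}=\gamma^e({\bf x})$ over an additive Gaussian noise channel with output ${\bf y}={\bf m}+{\bf v}$. The decoder also has access to a noisy observation ${\bf z}={\bf x}+{\bf w}$ of the source. It chooses a channel combining parameter $\alpha\in[0,1]$ (a deterministic number), receives ${\bf r}=\alpha{\bf y}+(1-\alpha){\bf z}$, and outputs the estimate $\hat{\bf x}=\gamma^d({\bf r})$, where $\gamma^d$ is a measurable function. *)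

theory Defs
  imports "HOL-Probability.Probability"
begin

definition received ::
  "('a \<Rightarrow> real) \<Rightarrow> ('a \<Rightarrow> real) \<Rightarrow> ('a \<Rightarrow> real) \<Rightarrow> (real \<Rightarrow> real) \<Rightarrow> real \<Rightarrow> 'a \<Rightarrow> real" where
  "received x v w enc \<alpha> \<omega> = \<alpha> * (enc (x \<omega>) + v \<omega>) + (1 - \<alpha>) * (x \<omega> + w \<omega>)"

(* The expectation of the nonnegative squared error is taken in [0, \<infinity>]: the Bochner
   integral would assign cost 0 to every decoder whose squared error is not integrable. *)
definition decoder_cost ::
  "'a measure \<Rightarrow> ('a \<Rightarrow> real) \<Rightarrow> ('a \<Rightarrow> real) \<Rightarrow> ('a \<Rightarrow> real) \<Rightarrow> (real \<Rightarrow> real) \<Rightarrow>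
    real \<Rightarrow> (real \<Rightarrow> real) \<Rightarrow> ennreal" where
  "decoder_cost M x v w enc \<alpha> dec =
    (\<integral>\<^sup>+ \<omega>. ennreal ((x \<omega> - dec (received x v w enc \<alpha> \<omega>))\<^sup>2) \<partial>M)"

definition decoder_strategies :: "(real \<times> (real \<Rightarrow> real)) set" where
  "decoder_strategies = {0..1} \<times> borel_measurable borel"

definition optimal_cost ::
  "'a measure \<Rightarrow> ('a \<Rightarrow> real) \<Rightarrow> ('a \<Rightarrow> real) \<Rightarrow> ('a \<Rightarrow> real) \<Rightarrow> (real \<Rightarrow> real) \<Rightarrow> ennreal" where
  "optimal_cost M x v w enc =
    (INF (\<alpha>, dec) \<in> decoder_strategies. decoder_cost M x v w enc \<alpha> dec)"

definition optimal_decoder ::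
  "'a measure \<Rightarrow> ('a \<Rightarrow> real) \<Rightarrow> ('a \<Rightarrow> real) \<Rightarrow> ('a \<Rightarrow> real) \<Rightarrow> (real \<Rightarrow> real) \<Rightarrow>
    real \<Rightarrow> (real \<Rightarrow> real) \<Rightarrow> bool" where
  "optimal_decoder M x v w enc \<alpha> dec \<longleftrightarrow>
    (\<alpha>, dec) \<in> decoder_strategies \<and>
    (\<forall>(\<alpha>', dec') \<in> decoder_strategies.
      decoder_cost M x v w enc \<alpha> dec \<le> decoder_cost M x v w enc \<alpha>' dec')"

end

theory Submission
  imports Defs
begin

text \<open>
  Fix the combining parameter \<open>\<alpha>\<close>. The received signal is \<open>r = h x + n\<close> with gain
  \<open>h = \<alpha> A + (1 - \<alpha>)\<close> and noise \<open>n = \<alpha> v + (1 - \<alpha>) w\<close>, which is a centred Gaussian independent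
  of the source and of variance \<open>s\<^sup>2 = \<alpha>\<^sup>2 \<sigma>v\<^sup>2 + (1 - \<alpha>)\<^sup>2 \<sigma>w\<^sup>2 > 0\<close>
  (lemma \<open>linear_combination_normal\<close>). Bayes' rule for Gaussians says that, given \<open>r\<close>, the source
  is again Gaussian, with mean \<open>K r\<close> linear in \<open>r\<close> and with a variance \<open>D\<close> that is the same for
  all \<open>r\<close> (lemma \<open>nn_integral_gaussian_channel\<close>). Hence every decoder \<open>\<delta>\<close> has cost
  \<open>D + E (K r - \<delta>(r))\<^sup>2\<close> (lemma \<open>nn_integral_gaussian_channel_error\<close>). For this \<open>\<alpha>\<close> the least
  cost is therefore \<open>D\<close>, the decoder \<open>K r\<close> attains it, and any other minimiser agrees with
  \<open>K r\<close> almost surely.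

  What is left is to minimise \<open>D = \<sigma>x\<^sup>2 s\<^sup>2 / (h\<^sup>2 \<sigma>x\<^sup>2 + s\<^sup>2)\<close> over \<open>\<alpha> \<in> [0, 1]\<close>, that is, to
  maximise the signal-to-noise ratio \<open>h\<^sup>2 / s\<^sup>2\<close>. For \<open>A \<ge> 0\<close> the maximum over all real \<open>\<alpha>\<close>, given by
  the Cauchy-Schwarz inequality, lies in the interval. For \<open>A \<le> 0\<close> the two terms of \<open>h\<close> have
  opposite signs, so \<open>\<bar>h\<bar>\<close> is at most the larger of \<open>1 - \<alpha>\<close> and \<open>\<alpha> \<bar>A\<bar>\<close>, and the better of the
  two single signals wins: the side observation or the channel output, according as \<open>\<bar>A\<bar>\<close> is
  below or above \<open>\<sigma>v / \<sigma>w\<close>.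
\<close>

section \<open>Gaussian source in independent Gaussian noise\<close>

text \<open>
  Scaling by \<open>0\<close> leaves the class of variables with a density, so the terms with
  coefficient \<open>0\<close> are removed before the variables are scaled and added.
\<close>
lemma (in prob_space) linear_combination_normal:
  fixes X :: "'i \<Rightarrow> 'a \<Rightarrow> real"
  assumes I: "finite I" and ind: "indep_vars (\<lambda>_. borel) X I"
    and pos: "\<And>i. i \<in> I \<Longrightarrow> 0 < \<sigma> i"
    and normal: "\<And>i. i \<in> I \<Longrightarrow> distributed M lborel (X i) (normal_density 0 (\<sigma> i))"
    and nz: "\<exists>i\<in>I. c i \<noteq> 0"
  shows "distributed M lborel (\<lambda>\<omega>. \<Sum>i\<in>I. c i * X i \<omega>)
    (normal_density 0 (sqrt (\<Sum>i\<in>I. (c i * \<sigma> i)\<^sup>2)))"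
proof -
  define J where "J = {i \<in> I. c i \<noteq> 0}"
  have J: "finite J" "J \<noteq> {}" "J \<subseteq> I"
    using I nz by (auto simp: J_def)
  have "indep_vars (\<lambda>_. borel) (\<lambda>i \<omega>. c i * X i \<omega>) J"
    by (rule indep_vars_compose2[OF indep_vars_subset[OF ind J(3)]]) simp
  moreover have "distributed M lborel (\<lambda>\<omega>. c i * X i \<omega>) (normal_density 0 (\<bar>c i\<bar> * \<sigma> i))"
    if "i \<in> J" for i
    using normal_density_affine[OF normal pos, of i "c i" 0] that by (auto simp: J_def)
  ultimately have "distributed M lborel (\<lambda>\<omega>. \<Sum>i\<in>J. c i * X i \<omega>)
      (normal_density (\<Sum>i\<in>J. 0) (sqrt (\<Sum>i\<in>J. (\<bar>c i\<bar> * \<sigma> i)\<^sup>2)))"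
    using J pos by (intro sum_indep_normal) (auto simp: J_def)
  moreover have "(\<Sum>i\<in>J. c i * X i \<omega>) = (\<Sum>i\<in>I. c i * X i \<omega>)" for \<omega>
    using I by (intro sum.mono_neutral_left) (auto simp: J_def)
  moreover have "(\<Sum>i\<in>J. (\<bar>c i\<bar> * \<sigma> i)\<^sup>2) = (\<Sum>i\<in>I. (c i * \<sigma> i)\<^sup>2)"
    using I by (intro sum.mono_neutral_cong_left) (auto simp: J_def power_mult_distrib)
  ultimately show ?thesis
    by simp
qed

lemma nn_integral_normal_square_error:
  assumes "0 < \<sigma>"
  shows "(\<integral>\<^sup>+t. ennreal (normal_density \<mu> \<sigma> t) * ennreal ((t - c)\<^sup>2) \<partial>lborel)
    = ennreal (\<sigma>\<^sup>2 + (\<mu> - c)\<^sup>2)"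
proof -
  let ?N = "normal_density \<mu> \<sigma>"
  have "has_bochner_integral lborel (\<lambda>t. ?N t * (t - \<mu>)\<^sup>2) (\<sigma>\<^sup>2)"
    using normal_moment_even[OF assms, of \<mu> 1] by (simp add: fact_numeral)
  moreover have "has_bochner_integral lborel (\<lambda>t. ?N t * (t - \<mu>) * (2 * (\<mu> - c))) (0 * (2 * (\<mu> - c)))"
    using normal_moment_odd[OF assms, of \<mu> 0] by (intro has_bochner_integral_mult_left) simp
  moreover have "has_bochner_integral lborel (\<lambda>t. ?N t * (\<mu> - c)\<^sup>2) (1 * (\<mu> - c)\<^sup>2)"
    using normal_moment_even[OF assms, of \<mu> 0] by (intro has_bochner_integral_mult_left) simp
  ultimately have "has_bochner_integral lborel
      (\<lambda>t. ?N t * (t - \<mu>)\<^sup>2 + (?N t * (t - \<mu>) * (2 * (\<mu> - c)) + ?N t * (\<mu> - c)\<^sup>2))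
      (\<sigma>\<^sup>2 + (0 * (2 * (\<mu> - c)) + 1 * (\<mu> - c)\<^sup>2))"
    by (intro has_bochner_integral_add)
  also have "(\<lambda>t. ?N t * (t - \<mu>)\<^sup>2 + (?N t * (t - \<mu>) * (2 * (\<mu> - c)) + ?N t * (\<mu> - c)\<^sup>2))
      = (\<lambda>t. ?N t * (t - c)\<^sup>2)"
    by (rule ext) (simp add: power2_eq_square algebra_simps)
  finally have "has_bochner_integral lborel (\<lambda>t. ?N t * (t - c)\<^sup>2) (\<sigma>\<^sup>2 + (\<mu> - c)\<^sup>2)"
    by simp
  then have "(\<integral>\<^sup>+t. ennreal (?N t * (t - c)\<^sup>2) \<partial>lborel) = ennreal (\<sigma>\<^sup>2 + (\<mu> - c)\<^sup>2)"
    by (subst nn_integral_eq_integral) (auto simp: has_bochner_integral_iff)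
  then show ?thesis
    by (simp add: ennreal_mult')
qed

text \<open>
  Bayes' rule for densities: prior times likelihood equals posterior times marginal. Completing
  the square in \<open>t\<close> shows that the posterior is Gaussian.
\<close>
lemma normal_density_bayes:
  fixes \<sigma> s h :: real
  assumes "0 < \<sigma>" "0 < s"
  defines "V \<equiv> h\<^sup>2 * \<sigma>\<^sup>2 + s\<^sup>2"
  shows "normal_density 0 \<sigma> t * normal_density 0 s (r - h * t) =
    normal_density 0 (sqrt V) r * normal_density (h * \<sigma>\<^sup>2 / V * r) (sqrt (\<sigma>\<^sup>2 * s\<^sup>2 / V)) t"
proof -
  have V: "0 < V"
    using assms by (simp add: V_def add_nonneg_pos)
  have "\<sigma>\<^sup>2 * s\<^sup>2 * V * (t\<^sup>2 / \<sigma>\<^sup>2 + (r - h * t)\<^sup>2 / s\<^sup>2) = V * (s\<^sup>2 * t\<^sup>2 + \<sigma>\<^sup>2 * (r - h * t)\<^sup>2)"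
    using assms(1,2) by (simp add: field_simps)
  also have "\<dots> = \<sigma>\<^sup>2 * s\<^sup>2 * r\<^sup>2 + (V * t - h * \<sigma>\<^sup>2 * r)\<^sup>2"
    unfolding V_def by algebra
  also have "V * t - h * \<sigma>\<^sup>2 * r = V * (t - h * \<sigma>\<^sup>2 / V * r)"
    using V by (simp add: field_simps)
  also have "\<sigma>\<^sup>2 * s\<^sup>2 * r\<^sup>2 + (V * (t - h * \<sigma>\<^sup>2 / V * r))\<^sup>2
      = \<sigma>\<^sup>2 * s\<^sup>2 * V * (r\<^sup>2 / V + (t - h * \<sigma>\<^sup>2 / V * r)\<^sup>2 / (\<sigma>\<^sup>2 * s\<^sup>2 / V))"
    using V assms(1,2) by (simp add: power_mult_distrib distrib_left power2_eq_square[of V])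
  finally have "t\<^sup>2 / \<sigma>\<^sup>2 + (r - h * t)\<^sup>2 / s\<^sup>2
      = r\<^sup>2 / V + (t - h * \<sigma>\<^sup>2 / V * r)\<^sup>2 / (\<sigma>\<^sup>2 * s\<^sup>2 / V)"
    using V assms(1,2) by simp
  then have "exp (- (t\<^sup>2 / \<sigma>\<^sup>2 + (r - h * t)\<^sup>2 / s\<^sup>2) / 2)
      = exp (- (r\<^sup>2 / V + (t - h * \<sigma>\<^sup>2 / V * r)\<^sup>2 / (\<sigma>\<^sup>2 * s\<^sup>2 / V)) / 2)"
    by simp
  then have e: "exp (- t\<^sup>2 / (2 * \<sigma>\<^sup>2)) * exp (- (r - h * t)\<^sup>2 / (2 * s\<^sup>2))
      = exp (- r\<^sup>2 / (2 * V)) * exp (- (t - h * \<sigma>\<^sup>2 / V * r)\<^sup>2 / (2 * (\<sigma>\<^sup>2 * s\<^sup>2 / V)))"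
    unfolding exp_add[symmetric] by (simp add: add_divide_distrib mult.commute)
  have "sqrt (2 * pi * \<sigma>\<^sup>2) * sqrt (2 * pi * s\<^sup>2)
      = sqrt (2 * pi * V) * sqrt (2 * pi * (\<sigma>\<^sup>2 * s\<^sup>2 / V))"
    unfolding real_sqrt_mult[symmetric] using V by simp
  moreover have "(sqrt V)\<^sup>2 = V" "(sqrt (\<sigma>\<^sup>2 * s\<^sup>2 / V))\<^sup>2 = \<sigma>\<^sup>2 * s\<^sup>2 / V"
    using V by simp_all
  moreover have "1 / a * p * (1 / b * q) = p * q / (a * b)" for a b p q :: real
    by simp
  ultimately show ?thesis
    unfolding normal_density_def using e by (simp only: diff_zero)
qed

text \<open>
  The shear \<open>(t, u) \<mapsto> (t, h t + u)\<close> preserves Lebesgue measure, so the pair \<open>(x, r)\<close> has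
  the density that Bayes' rule factorises. The right-hand side first averages over the conditional law
  of the source given \<open>r\<close>, then over the law of \<open>r\<close>.
\<close>
lemma (in prob_space) nn_integral_gaussian_channel:
  fixes x n :: "'a \<Rightarrow> real" and \<sigma> s h :: real and F :: "real \<times> real \<Rightarrow> ennreal"
  assumes pos: "0 < \<sigma>" "0 < s"
    and x: "distributed M lborel x (normal_density 0 \<sigma>)"
    and n: "distributed M lborel n (normal_density 0 s)"
    and ind: "indep_var borel x borel n"
    and F[measurable]: "F \<in> borel_measurable (borel \<Otimes>\<^sub>M borel)"
  defines "V \<equiv> h\<^sup>2 * \<sigma>\<^sup>2 + s\<^sup>2"
  shows "(\<integral>\<^sup>+\<omega>. F (x \<omega>, h * x \<omega> + n \<omega>) \<partial>M) =
    (\<integral>\<^sup>+r. ennreal (normal_density 0 (sqrt V) r) *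
      (\<integral>\<^sup>+t. ennreal (normal_density (h * \<sigma>\<^sup>2 / V * r) (sqrt (\<sigma>\<^sup>2 * s\<^sup>2 / V)) t) * F (t, r) \<partial>lborel) \<partial>lborel)"
proof -
  have "indep_var lborel x lborel n"
    using indep_var_compose[OF ind, of id lborel id lborel] by simp
  then have J: "distributed M (lborel \<Otimes>\<^sub>M lborel) (\<lambda>\<omega>. (x \<omega>, n \<omega>))
      (\<lambda>(t, u). ennreal (normal_density 0 \<sigma> t) * ennreal (normal_density 0 s u))"
    using x n by (intro distributed_joint_indep) (auto simp: sigma_finite_lborel)
  have "(\<integral>\<^sup>+\<omega>. F (x \<omega>, h * x \<omega> + n \<omega>) \<partial>M) =
      (\<integral>\<^sup>+p. (case p of (t, u) \<Rightarrow> ennreal (normal_density 0 \<sigma> t) * ennreal (normal_density 0 s u)) *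
        F (fst p, h * fst p + snd p) \<partial>(lborel \<Otimes>\<^sub>M lborel))"
    by (subst distributed_nn_integral[OF J]) auto
  also have "\<dots> = (\<integral>\<^sup>+t. \<integral>\<^sup>+u. ennreal (normal_density 0 \<sigma> t) * ennreal (normal_density 0 s u) *
        F (t, h * t + u) \<partial>lborel \<partial>lborel)"
    by (subst lborel.nn_integral_fst[symmetric]) auto
  also have "\<dots> = (\<integral>\<^sup>+t. \<integral>\<^sup>+r. ennreal (normal_density 0 \<sigma> t * normal_density 0 s (r - h * t)) *
        F (t, r) \<partial>lborel \<partial>lborel)"
  proof (rule nn_integral_cong)
    fix t :: real
    \<comment> \<open>For fixed \<open>t\<close>, substitute \<open>u = r - h t\<close>.\<close>
    show "(\<integral>\<^sup>+u. ennreal (normal_density 0 \<sigma> t) * ennreal (normal_density 0 s u) *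
          F (t, h * t + u) \<partial>lborel) =
        (\<integral>\<^sup>+r. ennreal (normal_density 0 \<sigma> t * normal_density 0 s (r - h * t)) * F (t, r) \<partial>lborel)"
      by (subst nn_integral_real_affine[where c = 1 and t = "- (h * t)"])
         (auto simp: ennreal_mult' algebra_simps)
  qed
  also have "\<dots> = (\<integral>\<^sup>+r. \<integral>\<^sup>+t. ennreal (normal_density 0 \<sigma> t * normal_density 0 s (r - h * t)) *
        F (t, r) \<partial>lborel \<partial>lborel)"
    by (rule lborel_pair.Fubini'[symmetric]) simp
  also have "\<dots> = (\<integral>\<^sup>+r. ennreal (normal_density 0 (sqrt V) r) *
      (\<integral>\<^sup>+t. ennreal (normal_density (h * \<sigma>\<^sup>2 / V * r) (sqrt (\<sigma>\<^sup>2 * s\<^sup>2 / V)) t) * F (t, r) \<partial>lborel) \<partial>lborel)"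
    unfolding V_def normal_density_bayes[OF pos]
    by (subst nn_integral_cmult[symmetric]) (auto simp: ennreal_mult' mult.assoc)
  finally show ?thesis .
qed

text \<open>
  Both sides are integrated against the law of \<open>r\<close>. Given \<open>r\<close>, the squared distance of a
  Gaussian to the point \<open>\<delta>(r)\<close> averages to its variance plus the squared bias.
\<close>
lemma (in prob_space) nn_integral_gaussian_channel_error:
  fixes x n :: "'a \<Rightarrow> real" and \<sigma> s h :: real
  assumes pos: "0 < \<sigma>" "0 < s"
    and x: "distributed M lborel x (normal_density 0 \<sigma>)"
    and n: "distributed M lborel n (normal_density 0 s)"
    and ind: "indep_var borel x borel n"
    and dec[measurable]: "\<delta> \<in> borel_measurable borel"
  defines "V \<equiv> h\<^sup>2 * \<sigma>\<^sup>2 + s\<^sup>2"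
  shows "(\<integral>\<^sup>+\<omega>. ennreal ((x \<omega> - \<delta> (h * x \<omega> + n \<omega>))\<^sup>2) \<partial>M) =
    ennreal (\<sigma>\<^sup>2 * s\<^sup>2 / V) +
    (\<integral>\<^sup>+\<omega>. ennreal ((h * \<sigma>\<^sup>2 / V * (h * x \<omega> + n \<omega>) - \<delta> (h * x \<omega> + n \<omega>))\<^sup>2) \<partial>M)"
proof -
  have V: "0 < V"
    using pos by (simp add: V_def add_nonneg_pos)
  define K where "K = h * \<sigma>\<^sup>2 / V"
  define D where "D = \<sigma>\<^sup>2 * s\<^sup>2 / V"
  have D: "0 < D"
    using pos V by (simp add: D_def)
  note channel = nn_integral_gaussian_channel[OF pos x n ind, of _ h, folded V_def, folded K_def D_def]
  have total: "(\<integral>\<^sup>+t. ennreal (normal_density \<mu> \<tau> t) \<partial>lborel) = 1" if "0 < \<tau>" for \<mu> \<tau>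
    using that by (subst nn_integral_eq_integral) (auto simp: integrable_normal_density)
  have split: "ennreal (D + b\<^sup>2) = ennreal D + ennreal (b\<^sup>2)" for b
    using D by (intro ennreal_plus) auto
  have "(\<integral>\<^sup>+\<omega>. ennreal ((x \<omega> - \<delta> (h * x \<omega> + n \<omega>))\<^sup>2) \<partial>M) =
      (\<integral>\<^sup>+r. ennreal (normal_density 0 (sqrt V) r) * (ennreal D + ennreal ((K * r - \<delta> r)\<^sup>2)) \<partial>lborel)"
    using channel[of "\<lambda>(t, r). ennreal ((t - \<delta> r)\<^sup>2)"] D
    by (simp add: nn_integral_normal_square_error split)
  also have "\<dots> = ennreal D +
      (\<integral>\<^sup>+r. ennreal (normal_density 0 (sqrt V) r) * ennreal ((K * r - \<delta> r)\<^sup>2) \<partial>lborel)"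
    using V by (simp add: distrib_left nn_integral_add nn_integral_multc total)
  also have "(\<integral>\<^sup>+r. ennreal (normal_density 0 (sqrt V) r) * ennreal ((K * r - \<delta> r)\<^sup>2) \<partial>lborel) =
      (\<integral>\<^sup>+\<omega>. ennreal ((K * (h * x \<omega> + n \<omega>) - \<delta> (h * x \<omega> + n \<omega>))\<^sup>2) \<partial>M)"
    using channel[of "\<lambda>(t, r). ennreal ((K * r - \<delta> r)\<^sup>2)"] D
    by (simp add: nn_integral_multc total)
  finally show ?thesis
    unfolding K_def D_def .
qed

section \<open>The signal-to-noise ratio\<close>

text \<open>
  The Cauchy-Schwarz inequality for \<open>(A / p) (\<alpha> p) + (1 / q) ((1 - \<alpha>) q)\<close>, cleared of
  denominators; below, \<open>p\<close> and \<open>q\<close> are \<open>\<sigma>v\<close> and \<open>\<sigma>w\<close>.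
\<close>
lemma gain_sq_le_nonneg:
  fixes A \<alpha> p q :: real
  shows "(\<alpha> * A + (1 - \<alpha>))\<^sup>2 * (p\<^sup>2 * q\<^sup>2) \<le> (A\<^sup>2 * q\<^sup>2 + p\<^sup>2) * (\<alpha>\<^sup>2 * p\<^sup>2 + (1 - \<alpha>)\<^sup>2 * q\<^sup>2)"
proof -
  have "(A\<^sup>2 * q\<^sup>2 + p\<^sup>2) * (\<alpha>\<^sup>2 * p\<^sup>2 + (1 - \<alpha>)\<^sup>2 * q\<^sup>2) - (\<alpha> * A + (1 - \<alpha>))\<^sup>2 * (p\<^sup>2 * q\<^sup>2)
      = (\<alpha> * p\<^sup>2 - (1 - \<alpha>) * A * q\<^sup>2)\<^sup>2"
    by algebra
  then show ?thesis
    by (metis diff_ge_0_iff_ge zero_le_power2)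
qed

text \<open>The terms \<open>\<alpha> * A\<close> and \<open>1 - \<alpha>\<close> have opposite signs, so they partly cancel in the sum.\<close>
lemma gain_sq_le_max:
  fixes A \<alpha> :: real
  assumes "0 \<le> \<alpha>" "\<alpha> \<le> 1" "A \<le> 0"
  shows "(\<alpha> * A + (1 - \<alpha>))\<^sup>2 \<le> max (\<alpha>\<^sup>2 * A\<^sup>2) ((1 - \<alpha>)\<^sup>2)"
proof (cases "0 \<le> \<alpha> * A + (1 - \<alpha>)")
  case True
  then have "(\<alpha> * A + (1 - \<alpha>))\<^sup>2 \<le> (1 - \<alpha>)\<^sup>2"
    using assms by (intro power_mono) (auto simp: mult_nonneg_nonpos)
  then show ?thesis
    by simp
next
  case False
  then have "(- (\<alpha> * A + (1 - \<alpha>)))\<^sup>2 \<le> (- (\<alpha> * A))\<^sup>2"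
    using assms by (intro power_mono) auto
  then have "(\<alpha> * A + (1 - \<alpha>))\<^sup>2 \<le> \<alpha>\<^sup>2 * A\<^sup>2"
    by (simp only: power2_minus power_mult_distrib)
  then show ?thesis
    by simp
qed

lemma gain_sq_le_side:
  fixes A \<alpha> p q :: real
  assumes "0 \<le> \<alpha>" "\<alpha> \<le> 1" "A \<le> 0" "A\<^sup>2 * q\<^sup>2 \<le> p\<^sup>2"
  shows "(\<alpha> * A + (1 - \<alpha>))\<^sup>2 * q\<^sup>2 \<le> \<alpha>\<^sup>2 * p\<^sup>2 + (1 - \<alpha>)\<^sup>2 * q\<^sup>2"
proof -
  have "(\<alpha> * A + (1 - \<alpha>))\<^sup>2 * q\<^sup>2 \<le> max (\<alpha>\<^sup>2 * A\<^sup>2) ((1 - \<alpha>)\<^sup>2) * q\<^sup>2"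
    using assms by (intro mult_right_mono gain_sq_le_max) auto
  also have "\<dots> = max (\<alpha>\<^sup>2 * (A\<^sup>2 * q\<^sup>2)) ((1 - \<alpha>)\<^sup>2 * q\<^sup>2)"
    by (simp add: max_mult_distrib_right mult.assoc)
  also have "\<dots> \<le> \<alpha>\<^sup>2 * p\<^sup>2 + (1 - \<alpha>)\<^sup>2 * q\<^sup>2"
    using mult_left_mono[OF assms(4), of "\<alpha>\<^sup>2"] by (simp add: add_increasing add_increasing2)
  finally show ?thesis .
qed

lemma gain_sq_le_channel:
  fixes A \<alpha> p q :: real
  assumes "0 \<le> \<alpha>" "\<alpha> \<le> 1" "A \<le> 0" "p\<^sup>2 \<le> A\<^sup>2 * q\<^sup>2"
  shows "(\<alpha> * A + (1 - \<alpha>))\<^sup>2 * p\<^sup>2 \<le> A\<^sup>2 * (\<alpha>\<^sup>2 * p\<^sup>2 + (1 - \<alpha>)\<^sup>2 * q\<^sup>2)"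
proof -
  have "(\<alpha> * A + (1 - \<alpha>))\<^sup>2 * p\<^sup>2 \<le> max (\<alpha>\<^sup>2 * A\<^sup>2) ((1 - \<alpha>)\<^sup>2) * p\<^sup>2"
    using assms by (intro mult_right_mono gain_sq_le_max) auto
  also have "\<dots> = max (A\<^sup>2 * (\<alpha>\<^sup>2 * p\<^sup>2)) ((1 - \<alpha>)\<^sup>2 * p\<^sup>2)"
    by (simp add: max_mult_distrib_right) (simp add: mult_ac)
  also have "\<dots> \<le> A\<^sup>2 * (\<alpha>\<^sup>2 * p\<^sup>2) + A\<^sup>2 * ((1 - \<alpha>)\<^sup>2 * q\<^sup>2)"
    using mult_left_mono[OF assms(4), of "(1 - \<alpha>)\<^sup>2"]
    by (simp add: add_increasing add_increasing2 mult_ac)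
  finally show ?thesis
    by (simp add: distrib_left)
qed

text \<open>
  With \<open>a = h\<^sup>2\<close>, noise variance \<open>s\<close> and source variance \<open>X\<close>, the least error variance is
  \<open>X / (X (a / s) + 1)\<close>, a decreasing function of the signal-to-noise ratio \<open>a / s\<close>. The ratios are
  compared without denominators.
\<close>
lemma error_variance_antimono:
  fixes a b s t X :: real
  assumes "0 \<le> a" "0 \<le> b" "0 < s" "0 < t" "0 < X" "b * s \<le> a * t"
  shows "X * s / (a * X + s) \<le> X * t / (b * X + t)"
proof -
  have "0 < a * X + s" "0 < b * X + t"
    using assms by (auto simp: add_nonneg_pos)
  moreover have "X * X * (b * s) \<le> X * X * (a * t)"
    using assms by (intro mult_left_mono) auto
  ultimately show ?thesis
    by (simp add: frac_le_eq divide_simps algebra_simps)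
qed

section \<open>Optimal decoders\<close>

theorem mainTheorem1:
  fixes M :: "'a measure" and x v w :: "'a \<Rightarrow> real" and \<sigma>x \<sigma>v \<sigma>w A :: real
  assumes "prob_space M"
    and "\<sigma>x > 0" and "\<sigma>v > 0" and "\<sigma>w > 0"
    and "distributed M lborel x (normal_density 0 \<sigma>x)"
    and "distributed M lborel v (normal_density 0 \<sigma>v)"
    and "distributed M lborel w (normal_density 0 \<sigma>w)"
    and "prob_space.indep_vars M (\<lambda>_. borel) (\<lambda>i. [x, v, w] ! i) {0, 1, 2}"
  shows
    "(\<forall>\<alpha> dec. optimal_decoder M x v w (\<lambda>t. A * t) \<alpha> dec \<longrightarrow>
        (\<exists>K. AE \<omega> in M. dec (received x v w (\<lambda>t. A * t) \<alpha> \<omega>)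
                       = K * received x v w (\<lambda>t. A * t) \<alpha> \<omega>)) \<and>
     (A \<ge> 0 \<longrightarrow>
        optimal_decoder M x v w (\<lambda>t. A * t)
          (A * \<sigma>w\<^sup>2 / (A * \<sigma>w\<^sup>2 + \<sigma>v\<^sup>2))
          (\<lambda>r. (A * \<sigma>x\<^sup>2 * \<sigma>w\<^sup>2 + \<sigma>x\<^sup>2 * \<sigma>v\<^sup>2)
              / (A\<^sup>2 * \<sigma>x\<^sup>2 * \<sigma>w\<^sup>2 + \<sigma>x\<^sup>2 * \<sigma>v\<^sup>2 + \<sigma>w\<^sup>2 * \<sigma>v\<^sup>2) * r) \<and>
        optimal_cost M x v w (\<lambda>t. A * t)
          = ennreal (\<sigma>x\<^sup>2 * \<sigma>w\<^sup>2 * \<sigma>v\<^sup>2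
              / ((A\<^sup>2 * \<sigma>w\<^sup>2 + \<sigma>v\<^sup>2) * \<sigma>x\<^sup>2 + \<sigma>w\<^sup>2 * \<sigma>v\<^sup>2))) \<and>
     (- sqrt (\<sigma>v\<^sup>2 / \<sigma>w\<^sup>2) \<le> A \<and> A \<le> 0 \<longrightarrow>
        optimal_decoder M x v w (\<lambda>t. A * t) 0
          (\<lambda>r. \<sigma>x\<^sup>2 / (\<sigma>x\<^sup>2 + \<sigma>w\<^sup>2) * r) \<and>
        optimal_cost M x v w (\<lambda>t. A * t)
          = ennreal (\<sigma>x\<^sup>2 * \<sigma>w\<^sup>2 / (\<sigma>x\<^sup>2 + \<sigma>w\<^sup>2))) \<and>
     (A \<le> - sqrt (\<sigma>v\<^sup>2 / \<sigma>w\<^sup>2) \<longrightarrow>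
        optimal_decoder M x v w (\<lambda>t. A * t) 1
          (\<lambda>r. A * \<sigma>x\<^sup>2 / (A\<^sup>2 * \<sigma>x\<^sup>2 + \<sigma>v\<^sup>2) * r) \<and>
        optimal_cost M x v w (\<lambda>t. A * t)
          = ennreal (\<sigma>x\<^sup>2 * \<sigma>v\<^sup>2 / (A\<^sup>2 * \<sigma>x\<^sup>2 + \<sigma>v\<^sup>2)))"
proof -
  interpret prob_space M by fact
  define X P Q where "X = \<sigma>x\<^sup>2" and "P = \<sigma>v\<^sup>2" and "Q = \<sigma>w\<^sup>2"
  have pos: "0 < X" "0 < P" "0 < Q"
    using assms(2-4) by (auto simp: X_def P_def Q_def)
  define h where "h \<alpha> = \<alpha> * A + (1 - \<alpha>)" for \<alpha> :: real
  define S where "S \<alpha> = \<alpha>\<^sup>2 * P + (1 - \<alpha>)\<^sup>2 * Q" for \<alpha> :: real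
  define K where "K \<alpha> = h \<alpha> * X / ((h \<alpha>)\<^sup>2 * X + S \<alpha>)" for \<alpha>
  define D where "D \<alpha> = X * S \<alpha> / ((h \<alpha>)\<^sup>2 * X + S \<alpha>)" for \<alpha>
  let ?r = "received x v w (\<lambda>t. A * t)"
  let ?J = "decoder_cost M x v w (\<lambda>t. A * t)"
  have S: "0 < S \<alpha>" for \<alpha>
    using pos by (cases "\<alpha> = 0") (auto simp: S_def add_pos_nonneg)
  have [measurable]: "x \<in> borel_measurable M" "v \<in> borel_measurable M" "w \<in> borel_measurable M"
    using assms(5-7)[THEN distributed_measurable] by simp_all
  have r_meas[measurable]: "?r \<alpha> \<in> borel_measurable M" for \<alpha>
    unfolding received_def[abs_def] by measurable

  have cost: "?J \<alpha> \<delta> = ennreal (D \<alpha>) + (\<integral>\<^sup>+\<omega>. ennreal ((K \<alpha> * ?r \<alpha> \<omega> - \<delta> (?r \<alpha> \<omega>))\<^sup>2) \<partial>M)"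
    if dec: "\<delta> \<in> borel_measurable borel" for \<alpha> \<delta>
  proof -
    define Y where "Y i = [x, v, w] ! i" for i :: nat
    define c where "c i = [1, \<alpha>, 1 - \<alpha>] ! i" for i :: nat
    define \<sigma> where "\<sigma> i = [\<sigma>x, \<sigma>v, \<sigma>w] ! i" for i :: nat
    let ?n = "\<lambda>\<omega>. \<Sum>i\<in>{1, 2}. c i * Y i \<omega>"
    have Y: "indep_vars (\<lambda>_. borel) Y {0, 1, 2}"
      using assms(8) by (simp add: Y_def[abs_def])
    have "distributed M lborel ?n (normal_density 0 (sqrt (\<Sum>i\<in>{1, 2}. (c i * \<sigma> i)\<^sup>2)))"
      by (rule linear_combination_normal[OF _ indep_vars_subset[OF Y]])
         (use assms(3,4,6,7) in \<open>auto simp: Y_def c_def \<sigma>_def\<close>)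
    moreover have "(\<Sum>i\<in>{1, 2}. (c i * \<sigma> i)\<^sup>2) = S \<alpha>"
      by (simp add: c_def \<sigma>_def S_def P_def Q_def power_mult_distrib)
    ultimately have n: "distributed M lborel ?n (normal_density 0 (sqrt (S \<alpha>)))"
      by simp
    have "indep_vars (\<lambda>_. borel) (\<lambda>i \<omega>. c i * Y i \<omega>) (insert 0 {1, 2})"
      by (rule indep_vars_compose2[OF Y]) simp
    then have "indep_var borel (\<lambda>\<omega>. c 0 * Y 0 \<omega>) borel ?n"
      by (intro indep_vars_sum) auto
    then have ind: "indep_var borel x borel ?n"
      by (simp add: c_def Y_def)
    have r: "h \<alpha> * x \<omega> + ?n \<omega> = ?r \<alpha> \<omega>" for \<omega>
      by (simp add: received_def h_def c_def Y_def algebra_simps)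
    show ?thesis
      using nn_integral_gaussian_channel_error[OF assms(2) _ assms(5) n ind dec, of "h \<alpha>"] S[of \<alpha>]
      unfolding r by (simp add: decoder_cost_def K_def D_def X_def)
  qed
  have attained: "?J \<alpha> (\<lambda>r. K \<alpha> * r) = ennreal (D \<alpha>)" for \<alpha>
    by (subst cost) auto

  have linear: "AE \<omega> in M. \<delta> (?r \<alpha> \<omega>) = K \<alpha> * ?r \<alpha> \<omega>"
    if opt: "optimal_decoder M x v w (\<lambda>t. A * t) \<alpha> \<delta>" for \<alpha> \<delta>
  proof -
    have \<delta>[measurable]: "\<delta> \<in> borel_measurable borel" and "0 \<le> \<alpha>" "\<alpha> \<le> 1"
      using opt by (auto simp: optimal_decoder_def decoder_strategies_def)
    then have "(\<alpha>, \<lambda>r. K \<alpha> * r) \<in> decoder_strategies"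
      by (auto simp: decoder_strategies_def)
    then have "?J \<alpha> \<delta> \<le> ?J \<alpha> (\<lambda>r. K \<alpha> * r)"
      using opt unfolding optimal_decoder_def by blast
    then have "ennreal (D \<alpha>) + (\<integral>\<^sup>+\<omega>. ennreal ((K \<alpha> * ?r \<alpha> \<omega> - \<delta> (?r \<alpha> \<omega>))\<^sup>2) \<partial>M)
        \<le> ennreal (D \<alpha>) + 0"
      by (simp add: attained cost[OF \<delta>])
    then have "(\<integral>\<^sup>+\<omega>. ennreal ((K \<alpha> * ?r \<alpha> \<omega> - \<delta> (?r \<alpha> \<omega>))\<^sup>2) \<partial>M) = 0"
      by (subst (asm) ennreal_add_left_cancel_le) simp
    then have "AE \<omega> in M. ennreal ((K \<alpha> * ?r \<alpha> \<omega> - \<delta> (?r \<alpha> \<omega>))\<^sup>2) = 0"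
      by (subst (asm) nn_integral_0_iff_AE) auto
    then show ?thesis
      by eventually_elim simp
  qed

  have optimal: "optimal_decoder M x v w (\<lambda>t. A * t) \<alpha> (\<lambda>r. k * r) \<and>
      optimal_cost M x v w (\<lambda>t. A * t) = ennreal d"
    if \<alpha>: "0 \<le> \<alpha>" "\<alpha> \<le> 1" and kd: "k = K \<alpha>" "d = D \<alpha>"
      and snr: "\<And>\<beta>. 0 \<le> \<beta> \<Longrightarrow> \<beta> \<le> 1 \<Longrightarrow> (h \<beta>)\<^sup>2 * S \<alpha> \<le> (h \<alpha>)\<^sup>2 * S \<beta>" for \<alpha> k d
  proof -
    have mem: "(\<alpha>, \<lambda>r. k * r) \<in> decoder_strategies"
      using \<alpha> by (auto simp: decoder_strategies_def)
    have le: "ennreal d \<le> ?J \<beta> \<delta>" if "(\<beta>, \<delta>) \<in> decoder_strategies" for \<beta> \<delta>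
    proof -
      have \<beta>: "0 \<le> \<beta>" "\<beta> \<le> 1" and \<delta>: "\<delta> \<in> borel_measurable borel"
        using that by (auto simp: decoder_strategies_def)
      have "D \<alpha> \<le> D \<beta>"
        unfolding D_def using snr[OF \<beta>] S pos by (intro error_variance_antimono) auto
      then show ?thesis
        by (simp add: kd cost[OF \<delta>] ennreal_leI add_increasing2)
    qed
    have eq: "?J \<alpha> (\<lambda>r. k * r) = ennreal d"
      by (simp add: kd attained)
    have "optimal_cost M x v w (\<lambda>t. A * t) = ennreal d"
      unfolding optimal_cost_def
    proof (rule antisym)
      show "(INF (\<beta>, \<delta>)\<in>decoder_strategies. ?J \<beta> \<delta>) \<le> ennreal d"
        using mem eq by (intro INF_lower2[OF mem]) simp
      show "ennreal d \<le> (INF (\<beta>, \<delta>)\<in>decoder_strategies. ?J \<beta> \<delta>)"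
        using le by (intro INF_greatest) auto
    qed
    then show ?thesis
      using mem le eq by (auto simp: optimal_decoder_def)
  qed

  have threshold: "sqrt (\<sigma>v\<^sup>2 / \<sigma>w\<^sup>2) = \<sigma>v / \<sigma>w"
    using assms(3,4) by (simp add: real_sqrt_divide)

  show ?thesis
  proof (intro conjI impI allI)
    fix \<alpha> \<delta>
    assume "optimal_decoder M x v w (\<lambda>t. A * t) \<alpha> \<delta>"
    then show "\<exists>K. AE \<omega> in M. \<delta> (?r \<alpha> \<omega>) = K * ?r \<alpha> \<omega>"
      using linear by blast
  next
    assume A: "A \<ge> 0"
    define d \<alpha> where "d = A * Q + P" and "\<alpha> = A * Q / d"
    define G where "G = A\<^sup>2 * Q + P"
    have d: "0 < d" and G: "0 < G"
      using A pos by (auto simp: d_def G_def add_nonneg_pos)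
    have \<alpha>: "0 \<le> \<alpha>" "\<alpha> \<le> 1" "1 - \<alpha> = P / d"
      using A pos d by (auto simp: \<alpha>_def d_def field_simps)
    have h: "h \<alpha> = G / d"
      unfolding h_def \<alpha>(3) by (simp add: \<alpha>_def G_def power2_eq_square add_divide_distrib)
    have s: "S \<alpha> = G * (P * Q) / d\<^sup>2"
      unfolding S_def \<alpha>(3) unfolding \<alpha>_def G_def
      by (simp add: power_divide add_divide_distrib[symmetric]) (simp add: power2_eq_square algebra_simps)
    have den: "(h \<alpha>)\<^sup>2 * X + S \<alpha> = G * (G * X + P * Q) / d\<^sup>2"
      unfolding h s by (simp add: power_divide add_divide_distrib[symmetric]) (simp add: power2_eq_square algebra_simps)
    have pd: "0 < G * X + P * Q"
      using G pos by (simp add: add_pos_pos)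
    have K: "K \<alpha> = d * X / (G * X + P * Q)"
      unfolding K_def den unfolding h using d G pd by (simp add: power2_eq_square)
    have D: "D \<alpha> = X * P * Q / (G * X + P * Q)"
      unfolding D_def den unfolding s using d G pd by simp
    have "optimal_decoder M x v w (\<lambda>t. A * t) \<alpha>
          (\<lambda>r. (A * X * Q + X * P) / (A\<^sup>2 * X * Q + X * P + Q * P) * r) \<and>
        optimal_cost M x v w (\<lambda>t. A * t) = ennreal (X * Q * P / ((A\<^sup>2 * Q + P) * X + Q * P))"
    proof (rule optimal)
      show "(A * X * Q + X * P) / (A\<^sup>2 * X * Q + X * P + Q * P) = K \<alpha>"
        unfolding K by (simp add: d_def G_def algebra_simps)
      show "X * Q * P / ((A\<^sup>2 * Q + P) * X + Q * P) = D \<alpha>"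
        unfolding D by (simp add: G_def algebra_simps)
      fix \<beta> :: real
      have "(h \<beta>)\<^sup>2 * S \<alpha> = G / d\<^sup>2 * ((h \<beta>)\<^sup>2 * (P * Q))"
        by (simp add: s)
      also have "\<dots> \<le> G / d\<^sup>2 * (G * S \<beta>)"
        using gain_sq_le_nonneg[of \<beta> A \<sigma>v \<sigma>w] G
        by (intro mult_left_mono) (auto simp: h_def S_def G_def P_def Q_def)
      also have "\<dots> = (h \<alpha>)\<^sup>2 * S \<beta>"
        by (simp add: h power_divide power2_eq_square)
      finally show "(h \<beta>)\<^sup>2 * S \<alpha> \<le> (h \<alpha>)\<^sup>2 * S \<beta>" .
    qed (use \<alpha> in auto)
    then show "optimal_decoder M x v w (\<lambda>t. A * t) (A * \<sigma>w\<^sup>2 / (A * \<sigma>w\<^sup>2 + \<sigma>v\<^sup>2))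
          (\<lambda>r. (A * \<sigma>x\<^sup>2 * \<sigma>w\<^sup>2 + \<sigma>x\<^sup>2 * \<sigma>v\<^sup>2)
              / (A\<^sup>2 * \<sigma>x\<^sup>2 * \<sigma>w\<^sup>2 + \<sigma>x\<^sup>2 * \<sigma>v\<^sup>2 + \<sigma>w\<^sup>2 * \<sigma>v\<^sup>2) * r)"
      "optimal_cost M x v w (\<lambda>t. A * t)
          = ennreal (\<sigma>x\<^sup>2 * \<sigma>w\<^sup>2 * \<sigma>v\<^sup>2 / ((A\<^sup>2 * \<sigma>w\<^sup>2 + \<sigma>v\<^sup>2) * \<sigma>x\<^sup>2 + \<sigma>w\<^sup>2 * \<sigma>v\<^sup>2))"
      unfolding \<alpha>_def d_def X_def P_def Q_def by blast+
  next
    assume A: "- sqrt (\<sigma>v\<^sup>2 / \<sigma>w\<^sup>2) \<le> A \<and> A \<le> 0"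
    then have "- A * \<sigma>w \<le> \<sigma>v"
      using assms(3,4) unfolding threshold by (simp add: field_simps)
    then have "(- A * \<sigma>w)\<^sup>2 \<le> \<sigma>v\<^sup>2"
      using A assms(4) by (intro power_mono) (auto simp: mult_nonpos_nonneg)
    then have AQ: "A\<^sup>2 * \<sigma>w\<^sup>2 \<le> \<sigma>v\<^sup>2"
      by (simp add: power_mult_distrib)
    have "optimal_decoder M x v w (\<lambda>t. A * t) 0 (\<lambda>r. X / (X + Q) * r) \<and>
        optimal_cost M x v w (\<lambda>t. A * t) = ennreal (X * Q / (X + Q))"
    proof (rule optimal)
      fix \<beta> :: real
      assume "0 \<le> \<beta>" "\<beta> \<le> 1"
      then show "(h \<beta>)\<^sup>2 * S 0 \<le> (h 0)\<^sup>2 * S \<beta>"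
        using gain_sq_le_side[OF _ _ _ AQ] A by (simp add: h_def S_def P_def Q_def)
    qed (auto simp: K_def D_def h_def S_def)
    then show "optimal_decoder M x v w (\<lambda>t. A * t) 0 (\<lambda>r. \<sigma>x\<^sup>2 / (\<sigma>x\<^sup>2 + \<sigma>w\<^sup>2) * r)"
      "optimal_cost M x v w (\<lambda>t. A * t) = ennreal (\<sigma>x\<^sup>2 * \<sigma>w\<^sup>2 / (\<sigma>x\<^sup>2 + \<sigma>w\<^sup>2))"
      unfolding X_def Q_def by blast+
  next
    assume A: "A \<le> - sqrt (\<sigma>v\<^sup>2 / \<sigma>w\<^sup>2)"
    then have "\<sigma>v \<le> - A * \<sigma>w"
      using assms(3,4) unfolding threshold by (simp add: field_simps)
    then have "\<sigma>v\<^sup>2 \<le> (- A * \<sigma>w)\<^sup>2"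
      using assms(3) by (intro power_mono) auto
    then have AQ: "\<sigma>v\<^sup>2 \<le> A\<^sup>2 * \<sigma>w\<^sup>2"
      by (simp add: power_mult_distrib)
    have A0: "A \<le> 0"
      using A by (rule order_trans) simp
    have "optimal_decoder M x v w (\<lambda>t. A * t) 1 (\<lambda>r. A * X / (A\<^sup>2 * X + P) * r) \<and>
        optimal_cost M x v w (\<lambda>t. A * t) = ennreal (X * P / (A\<^sup>2 * X + P))"
    proof (rule optimal)
      fix \<beta> :: real
      assume "0 \<le> \<beta>" "\<beta> \<le> 1"
      then show "(h \<beta>)\<^sup>2 * S 1 \<le> (h 1)\<^sup>2 * S \<beta>"
        using gain_sq_le_channel[OF _ _ A0 AQ] by (simp add: h_def S_def P_def Q_def)
    qed (auto simp: K_def D_def h_def S_def)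
    then show "optimal_decoder M x v w (\<lambda>t. A * t) 1 (\<lambda>r. A * \<sigma>x\<^sup>2 / (A\<^sup>2 * \<sigma>x\<^sup>2 + \<sigma>v\<^sup>2) * r)"
      "optimal_cost M x v w (\<lambda>t. A * t) = ennreal (\<sigma>x\<^sup>2 * \<sigma>v\<^sup>2 / (A\<^sup>2 * \<sigma>x\<^sup>2 + \<sigma>v\<^sup>2))"
      unfolding X_def P_def by blast+
  qed
qed

end
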